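(* Let $\mathbf{X}$ be a three-valued scheme. Then $\vDash^{tt}_{\mathbf{X}} \ =\ \vDash_2$ if and only if $\mathbf{X}$ is truth-collapsible.
   Context: Language: $P$ is a denumerable (countably infinite) set of propositional variables, and $\mathcal{L}$ is the set of formulae generated from $P$ by the connectives $\neg$ (unary), $\wedge$, $\vee$ (binary). $\Gamma,\Delta$ range over arbitrary sets of formulae; a consequence relation is a set of pairs $(\Gamma,\Delta)$. Classical consequence $\vDash_2$: $\Gamma\vDash_2\Delta$ iff for every $v:\mathcal{L}\to\{0,1\}$ with $v(\neg A)=1-v(A)$, $v(A\wedge B)=\min(v(A),v(B))$, $v(A\vee B)=\max(v(A),v(B))$: if $v(A)=1$ for every $A\in\Gamma$, then $v(B)=1$ for some $B\in\Delta$. A three-valued scheme is a triple $\mathbf{X}=(f_\neg,f_\wedge,f_\vee)$ of operations on $\{1,\tfrac12,0\}$ (of arity $1,2,2$). An $\mathbf{X}$-valuation is a map $v:\mathcal{L}\to\{1,\tfrac12,0\}$ with $v(\neg A)=f_\neg(v(A))$, $v(A\wedge B)=f_\wedge(v(A),v(B))$, $v(A\vee B)=f_\vee(v(A),v(B))$. $\Gamma\vDash^{tt}_{\mathbf{X}}\Delta$ iff for every $\mathbf{X}$-valuation $v$: if $v(A)\in\{1,\tfrac12\}$ for every $A\in\Gamma$, then $v(B)\in\{1,\tfrac12\}$ for some $B\in\Delta$. Truth-collapsibility: let $\tau_1:\{1,\tfrac12,0\}\to\{0,1\}$ be given by $\tau_1(0)=0$, $\tau_1(1)=1$, $\tau_1(\tfrac12)=1$.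 The scheme $\mathbf{X}$ is truth-collapsible ($1$-collapsible) iff for all $x,y\in\{1,\tfrac12,0\}$: $\tau_1(f_\neg(x))=1-\tau_1(x)$, $\tau_1(f_\wedge(x,y))=\min(\tau_1(x),\tau_1(y))$, and $\tau_1(f_\vee(x,y))=\max(\tau_1(x),\tau_1(y))$. *)

theory Defs
  imports "HOL-Library.Countable_Set"
begin

datatype 'p fm =
    Var 'p
  | Neg "'p fm"
  | Conj "'p fm" "'p fm"
  | Disj "'p fm" "'p fm"

type_synonym 'p consequence = "('p fm set \<times> 'p fm set) set"

(* The two classical values are the integers 0 and 1, so that 1 - x, min and max
   are literally the arithmetical operations. *)
definition classical_valuation :: "('p fm \<Rightarrow> int) \<Rightarrow> bool" where
  "classical_valuation v \<longleftrightarrow>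
     (\<forall>A. v A \<in> {0, 1}) \<and>
     (\<forall>A. v (Neg A) = 1 - v A) \<and>
     (\<forall>A B. v (Conj A B) = min (v A) (v B)) \<and>
     (\<forall>A B. v (Disj A B) = max (v A) (v B))"

definition classical_consequence :: "'p consequence" where
  "classical_consequence =
     {(\<Gamma>, \<Delta>). \<forall>v. classical_valuation v \<longrightarrow> (\<forall>A\<in>\<Gamma>. v A = 1) \<longrightarrow> (\<exists>B\<in>\<Delta>. v B = 1)}"

datatype three = One | Half | Zero

record three_valued_scheme =
  f_neg :: "three \<Rightarrow> three"
  f_conj :: "three \<Rightarrow> three \<Rightarrow> three"
  f_disj :: "three \<Rightarrow> three \<Rightarrow> three"

definition scheme_valuation :: "three_valued_scheme \<Rightarrow> ('p fm \<Rightarrow> three) \<Rightarrow> bool" where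
  "scheme_valuation X v \<longleftrightarrow>
     (\<forall>A. v (Neg A) = f_neg X (v A)) \<and>
     (\<forall>A B. v (Conj A B) = f_conj X (v A) (v B)) \<and>
     (\<forall>A B. v (Disj A B) = f_disj X (v A) (v B))"

definition tt_consequence :: "three_valued_scheme \<Rightarrow> 'p consequence" where
  "tt_consequence X =
     {(\<Gamma>, \<Delta>). \<forall>v. scheme_valuation X v \<longrightarrow>
        (\<forall>A\<in>\<Gamma>. v A \<in> {One, Half}) \<longrightarrow> (\<exists>B\<in>\<Delta>. v B \<in> {One, Half})}"

fun tau1 :: "three \<Rightarrow> int" where
  "tau1 Zero = 0"
| "tau1 One = 1"
| "tau1 Half = 1"

definition truth_collapsible :: "three_valued_scheme \<Rightarrow> bool" where
  "truth_collapsible X \<longleftrightarrow>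
     (\<forall>x. tau1 (f_neg X x) = 1 - tau1 x) \<and>
     (\<forall>x y. tau1 (f_conj X x y) = min (tau1 x) (tau1 y)) \<and>
     (\<forall>x y. tau1 (f_disj X x y) = max (tau1 x) (tau1 y))"

end

theory Submission
  imports Defs
begin

text \<open>
  Since premises and conclusions range over arbitrary sets, a consequence relation given by a set of
  two-valued functions determines that set: to detect whether \<open>w\<close> belongs to it, take as premises all
  formulae true under \<open>w\<close> and as conclusions all the others, so that \<open>w\<close> is the only possible
  countermodel. The lemma \<open>preserves_truth_inj\<close> makes this precise.

  Tolerant-tolerant consequence is truth preservation for the collapsed valuations \<open>tau1 \<circ> v\<close>. It
  is therefore classical exactly if the collapsed valuations are the classical valuations. If they
  are, then giving two distinct variables arbitrary values \<open>x\<close> and \<open>y\<close> reads off each equation of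
  truth-collapsibility. Conversely, truth-collapsibility says that \<open>tau1\<close> is a homomorphism onto the
  Boolean matrix. Composing with it preserves the valuation clauses, and every classical valuation
  arises so, because \<open>tau1\<close> is surjective and a classical valuation is fixed by its values on
  variables.
\<close>

definition preserves_truth :: "('f \<Rightarrow> int) set \<Rightarrow> ('f set \<times> 'f set) set" where
  "preserves_truth V = {(\<Gamma>, \<Delta>). \<forall>v\<in>V. (\<forall>A\<in>\<Gamma>. v A = 1) \<longrightarrow> (\<exists>B\<in>\<Delta>. v B = 1)}"

text \<open>
  The pair of the formulae true under \<open>w\<close> and the formulae untrue under \<open>w\<close> is refuted by \<open>w\<close>, and a
  two-valued function that refutes it agrees with \<open>w\<close> everywhere.
\<close>

lemma preserves_truth_subset_imp:
  assumes "preserves_truth V \<subseteq> preserves_truth W"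
    and V: "\<And>v A. v \<in> V \<Longrightarrow> v A \<in> {0, 1}"
    and W: "\<And>w A. w \<in> W \<Longrightarrow> w A \<in> {0, 1}"
  shows "W \<subseteq> V"
proof
  fix w assume w: "w \<in> W"
  have "({A. w A = 1}, {A. w A \<noteq> 1}) \<notin> preserves_truth W"
    using w by (auto simp: preserves_truth_def)
  with assms(1) have "({A. w A = 1}, {A. w A \<noteq> 1}) \<notin> preserves_truth V"
    by blast
  then obtain v where v: "v \<in> V" and agree: "\<And>A. v A = 1 \<longleftrightarrow> w A = 1"
    by (auto simp: preserves_truth_def)
  have "v A = w A" for A
    using V[OF v, of A] W[OF w, of A] agree[of A] by auto
  then have "v = w" ..
  with v show "w \<in> V" by simp
qed

lemma preserves_truth_inj:
  assumes "\<And>v A. v \<in> V \<Longrightarrow> v A \<in> {0, 1}"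
    and "\<And>w A. w \<in> W \<Longrightarrow> w A \<in> {0, 1}"
  shows "preserves_truth V = preserves_truth W \<longleftrightarrow> V = W"
  using preserves_truth_subset_imp[of V W] preserves_truth_subset_imp[of W V] assms by blast

lemma tau1_range: "tau1 x \<in> {0, 1}"
  by (cases x) auto

lemma tau1_eq_1_iff: "tau1 x = 1 \<longleftrightarrow> x \<in> {One, Half}"
  by (cases x) auto

definition collapsed_valuations :: "three_valued_scheme \<Rightarrow> ('p fm \<Rightarrow> int) set" where
  "collapsed_valuations X = {tau1 \<circ> v |v. scheme_valuation X v}"

lemma tt_consequence_eq_classical_iff:
  "(tt_consequence X :: 'p consequence) = classical_consequence \<longleftrightarrow>
     (collapsed_valuations X :: ('p fm \<Rightarrow> int) set) = Collect classical_valuation"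
proof -
  have "(tt_consequence X :: 'p consequence) = preserves_truth (collapsed_valuations X)"
    unfolding tt_consequence_def preserves_truth_def collapsed_valuations_def
    by (simp add: setcompr_eq_image tau1_eq_1_iff)
  moreover have "(classical_consequence :: 'p consequence)
      = preserves_truth (Collect classical_valuation)"
    unfolding classical_consequence_def preserves_truth_def by simp
  moreover have "u A \<in> {0, 1}" if "u \<in> collapsed_valuations X" for u :: "'p fm \<Rightarrow> int" and A
  proof -
    from that obtain v where "u = tau1 \<circ> v"
      by (auto simp: collapsed_valuations_def)
    then show ?thesis using tau1_range by simp
  qed
  moreover have "w A \<in> {0, 1}" if "w \<in> Collect classical_valuation" for w :: "'p fm \<Rightarrow> int" and A
    using that by (simp add: classical_valuation_def)
  ultimately show ?thesis
    using preserves_truth_inj[of "collapsed_valuations X" "Collect classical_valuation"]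
    by metis
qed

primrec evaluate :: "three_valued_scheme \<Rightarrow> ('p \<Rightarrow> three) \<Rightarrow> 'p fm \<Rightarrow> three" where
  "evaluate X s (Var p) = s p"
| "evaluate X s (Neg A) = f_neg X (evaluate X s A)"
| "evaluate X s (Conj A B) = f_conj X (evaluate X s A) (evaluate X s B)"
| "evaluate X s (Disj A B) = f_disj X (evaluate X s A) (evaluate X s B)"

lemma scheme_valuation_evaluate: "scheme_valuation X (evaluate X s)"
  by (simp add: scheme_valuation_def)

lemma classical_valuation_eqI:
  assumes "classical_valuation v" "classical_valuation w" "\<And>p. v (Var p) = w (Var p)"
  shows "v = w"
proof
  fix A show "v A = w A"
    using assms by (induction A) (simp_all add: classical_valuation_def)
qed

text \<open>
  Variables are free, so with two of them every pair of arguments of the connectives is attained.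
\<close>

lemma truth_collapsible_if_collapsed_classical:
  fixes p q :: 'p
  assumes "p \<noteq> q"
    and classical: "(collapsed_valuations X :: ('p fm \<Rightarrow> int) set) \<subseteq> Collect classical_valuation"
  shows "truth_collapsible X"
proof -
  have "tau1 (f_neg X x) = 1 - tau1 x \<and>
        tau1 (f_conj X x y) = min (tau1 x) (tau1 y) \<and>
        tau1 (f_disj X x y) = max (tau1 x) (tau1 y)" for x y
  proof -
    define v where "v = evaluate X ((\<lambda>_. y)(p := x))"
    have "classical_valuation (tau1 \<circ> v)"
      using classical scheme_valuation_evaluate
      unfolding collapsed_valuations_def v_def by blast
    then have "tau1 (v (Neg (Var p))) = 1 - tau1 (v (Var p))"
      "tau1 (v (Conj (Var p) (Var q))) = min (tau1 (v (Var p))) (tau1 (v (Var q)))"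
      "tau1 (v (Disj (Var p) (Var q))) = max (tau1 (v (Var p))) (tau1 (v (Var q)))"
      by (simp_all add: classical_valuation_def)
    then show ?thesis
      using \<open>p \<noteq> q\<close> by (simp add: v_def)
  qed
  then show ?thesis
    by (simp add: truth_collapsible_def)
qed

lemma classical_valuation_collapse:
  assumes "truth_collapsible X" "scheme_valuation X v"
  shows "classical_valuation (tau1 \<circ> v)"
  using assms tau1_range
  by (simp add: truth_collapsible_def scheme_valuation_def classical_valuation_def)

text \<open>
  A classical valuation \<open>w\<close> is recovered by evaluating the scheme on a lift of its values on variables
  along \<open>tau1\<close>: the collapse is again classical and agrees with \<open>w\<close> on variables.
\<close>

lemma collapsed_valuations_eq_classical:
  assumes "truth_collapsible X"
  shows "(collapsed_valuations X :: ('p fm \<Rightarrow> int) set) = Collect classical_valuation"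
proof (intro equalityI subsetI)
  fix u :: "'p fm \<Rightarrow> int"
  assume "u \<in> collapsed_valuations X"
  then show "u \<in> Collect classical_valuation"
    using classical_valuation_collapse[OF assms] by (auto simp: collapsed_valuations_def)
next
  fix w :: "'p fm \<Rightarrow> int"
  assume "w \<in> Collect classical_valuation"
  then have w: "classical_valuation w" by simp
  define v where "v = evaluate X (\<lambda>p. if w (Var p) = 1 then One else Zero)"
  have v: "scheme_valuation X v"
    unfolding v_def by (rule scheme_valuation_evaluate)
  have "w A = 0 \<or> w A = 1" for A
    using w by (auto simp: classical_valuation_def)
  then have "(tau1 \<circ> v) (Var p) = w (Var p)" for p
    by (auto simp: v_def)
  with w have "tau1 \<circ> v = w"
    by (intro classical_valuation_eqI classical_valuation_collapse[OF assms v])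
  with v show "w \<in> collapsed_valuations X"
    by (auto simp: collapsed_valuations_def)
qed

theorem theorem3p4:
  fixes X :: three_valued_scheme
  assumes "countable (UNIV :: 'p set)" and "infinite (UNIV :: 'p set)"
  shows "(tt_consequence X :: 'p consequence) = classical_consequence \<longleftrightarrow> truth_collapsible X"
proof -
  fix p :: 'p
  obtain q where "q \<noteq> p"
    using ex_new_if_finite[OF assms(2), of "{p}"] by auto
  then show ?thesis
    unfolding tt_consequence_eq_classical_iff
    using truth_collapsible_if_collapsed_classical collapsed_valuations_eq_classical
    by (metis order_refl)
qed

end
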